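(* There exists a dynamical system $(X,T)$ (a compact metric space $X$ with a continuous map $T\colon X\to X$) which has the weak specification property but does not have the almost specification property.
   Context: $\mathbb{N}=\{1,2,\ldots\}$, $\mathbb{Z}_+=\{0,1,\ldots\}$; $\rho$ denotes the metric on $X$. Weak specification. $(X,T)$ has the weak specification property if for every $\varepsilon>0$ there is a function $M_\varepsilon\colon\mathbb{Z}_+\to\mathbb{N}$ with $\lim_{n\to\infty}M_\varepsilon(n)/n=0$ such that for any $k\in\mathbb{N}$, any points $x_1,\ldots,x_k\in X$ and any integers $0\le a_1\le b_1<a_2\le b_2<\ldots<a_k\le b_k$ with $a_i-b_{i-1}\ge M_\varepsilon(b_i-a_i)$ for $i=2,\ldots,k$, there is a point $x\in X$ such that $\rho(T^j(x),T^j(x_i))\le\varepsilon$ for each $i=1,\ldots,k$ and $a_i\le j\le b_i$. Almost specification. A mistake function is a function $g\colon\mathbb{Z}_+\times(0,\varepsilon_0)\to\mathbb{N}$, for some $\varepsilon_0>0$, such that for all $\varepsilon<\varepsilon_0$ and $n\in\mathbb{Z}_+$ we have $g(n,\varepsilon)\le g(n+1,\varepsilon)$ and $\lim_{n\to\infty}g(n,\varepsilon)/n=0$. Let $k_g(\varepsilon)$ be the smallest $n\in\mathbb{N}$ such that $g(m,\varepsilon)<m\varepsilon$ for all $m\ge n$. For $n\ge k_g(\varepsilon)$ and $x\in X$ let $B_n(g;x,\varepsilon)$ be the set of all $y\in X$ for which there is $\Lambda\subset\{0,\ldots,n-1\}$ with $\#(\{0,\ldots,n-1\}\setminus\Lambda)\le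 g(n,\varepsilon)$ and $\rho(T^i(x),T^i(y))\le\varepsilon$ for all $i\in\Lambda$. $(X,T)$ has the almost specification property if there is a mistake function $g$ such that for all $m\ge1$, $\varepsilon_1,\ldots,\varepsilon_m\in(0,\varepsilon_0)$, $x_1,\ldots,x_m\in X$ and integers $0\le a_1\le b_1<a_2\le b_2<\ldots<a_m\le b_m$ with $n_j:=b_j-a_j+1\ge k_g(\varepsilon_j)$ for all $j$, there is $z\in X$ with $T^{a_j}(z)\in B_{n_j}(g;x_j,\varepsilon_j)$ for every $j=1,\ldots,m$. *)

theory Defs
  imports "HOL-Analysis.Abstract_Metric_Spaces"
begin

text \<open>A compact metric space has at most continuum many points, so up to isometry every
  compact metric space is a set of points of type \<open>nat \<Rightarrow> nat\<close> with some metric \<open>\<rho>\<close>; quantifying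
  over such \<open>X\<close> and \<open>\<rho>\<close> covers all compact metric spaces.\<close>
definition dynamical_system :: "'a set \<Rightarrow> ('a \<Rightarrow> 'a \<Rightarrow> real) \<Rightarrow> ('a \<Rightarrow> 'a) \<Rightarrow> bool" where
  "dynamical_system X \<rho> T \<longleftrightarrow>
     Metric_space X \<rho> \<and>
     compact_space (Metric_space.mtopology X \<rho>) \<and>
     continuous_map (Metric_space.mtopology X \<rho>) (Metric_space.mtopology X \<rho>) T"

text \<open>Integers \<open>0 \<le> a 1 \<le> b 1 < a 2 \<le> b 2 < \<dots> < a k \<le> b k\<close>;
  the values of \<open>a\<close> and \<open>b\<close> outside \<open>{1..k}\<close> are irrelevant.\<close>
definition interleaved :: "nat \<Rightarrow> (nat \<Rightarrow> nat) \<Rightarrow> (nat \<Rightarrow> nat) \<Rightarrow> bool" where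
  "interleaved k a b \<longleftrightarrow> (\<forall>i\<in>{1..k}. a i \<le> b i) \<and> (\<forall>i\<in>{2..k}. b (i - 1) < a i)"

text \<open>The gap condition uses subtraction on \<open>nat\<close>, which is exact here because
  \<open>interleaved k a b\<close> gives \<open>b (i - 1) < a i\<close> and \<open>a i \<le> b i\<close>.\<close>
definition weak_specification :: "'a set \<Rightarrow> ('a \<Rightarrow> 'a \<Rightarrow> real) \<Rightarrow> ('a \<Rightarrow> 'a) \<Rightarrow> bool" where
  "weak_specification X \<rho> T \<longleftrightarrow>
     (\<forall>\<epsilon>>0. \<exists>M :: nat \<Rightarrow> nat.
        (\<forall>n. M n \<ge> 1) \<and>
        (\<lambda>n. real (M n) / real n) \<longlonglongrightarrow> 0 \<and>
        (\<forall>k\<ge>1. \<forall>x :: nat \<Rightarrow> 'a. \<forall>a b :: nat \<Rightarrow> nat.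
           (\<forall>i\<in>{1..k}. x i \<in> X) \<and> interleaved k a b \<and>
           (\<forall>i\<in>{2..k}. a i - b (i - 1) \<ge> M (b i - a i)) \<longrightarrow>
           (\<exists>y\<in>X. \<forall>i\<in>{1..k}. \<forall>j\<in>{a i..b i}. \<rho> ((T ^^ j) y) ((T ^^ j) (x i)) \<le> \<epsilon>)))"

text \<open>Only the values \<open>g n \<epsilon>\<close> with \<open>0 < \<epsilon> < \<epsilon>0\<close> matter: \<open>\<epsilon>0\<close> delimits the domain of \<open>g\<close>.\<close>
definition mistake_function :: "real \<Rightarrow> (nat \<Rightarrow> real \<Rightarrow> nat) \<Rightarrow> bool" where
  "mistake_function \<epsilon>0 g \<longleftrightarrow>
     \<epsilon>0 > 0 \<and>
     (\<forall>\<epsilon>\<in>{0<..<\<epsilon>0}.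
        (\<forall>n. g n \<epsilon> \<ge> 1) \<and>
        (\<forall>n. g n \<epsilon> \<le> g (n + 1) \<epsilon>) \<and>
        (\<lambda>n. real (g n \<epsilon>) / real n) \<longlonglongrightarrow> 0)"

definition mistake_threshold :: "(nat \<Rightarrow> real \<Rightarrow> nat) \<Rightarrow> real \<Rightarrow> nat" where
  "mistake_threshold g \<epsilon> = (LEAST n. n \<ge> 1 \<and> (\<forall>m\<ge>n. real (g m \<epsilon>) < real m * \<epsilon>))"

definition mistake_ball ::
  "'a set \<Rightarrow> ('a \<Rightarrow> 'a \<Rightarrow> real) \<Rightarrow> ('a \<Rightarrow> 'a) \<Rightarrow> (nat \<Rightarrow> real \<Rightarrow> nat) \<Rightarrow> nat \<Rightarrow> 'a \<Rightarrow> real \<Rightarrow> 'a set" where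
  "mistake_ball X \<rho> T g n x \<epsilon> =
     {y \<in> X. \<exists>\<Lambda> \<subseteq> {0..<n}. card ({0..<n} - \<Lambda>) \<le> g n \<epsilon> \<and>
        (\<forall>i\<in>\<Lambda>. \<rho> ((T ^^ i) x) ((T ^^ i) y) \<le> \<epsilon>)}"

definition almost_specification :: "'a set \<Rightarrow> ('a \<Rightarrow> 'a \<Rightarrow> real) \<Rightarrow> ('a \<Rightarrow> 'a) \<Rightarrow> bool" where
  "almost_specification X \<rho> T \<longleftrightarrow>
     (\<exists>\<epsilon>0 g. mistake_function \<epsilon>0 g \<and>
        (\<forall>m\<ge>1. \<forall>\<epsilon> :: nat \<Rightarrow> real. \<forall>x :: nat \<Rightarrow> 'a. \<forall>a b :: nat \<Rightarrow> nat.
           (\<forall>j\<in>{1..m}. \<epsilon> j \<in> {0<..<\<epsilon>0}) \<and> (\<forall>j\<in>{1..m}. x j \<in> X) \<and> interleaved m a b \<and>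
           (\<forall>j\<in>{1..m}. b j - a j + 1 \<ge> mistake_threshold g (\<epsilon> j)) \<longrightarrow>
           (\<exists>z\<in>X. \<forall>j\<in>{1..m}.
              (T ^^ a j) z \<in> mistake_ball X \<rho> T g (b j - a j + 1) (x j) (\<epsilon> j))))"

end

theory Submission
  imports Defs
begin

text \<open>The alphabet is \<open>{0, 1, 2, \<dots>}\<close> with \<open>k \<rightarrow> 0\<close>, so that a coarse observer sees only the
  letters \<open>0\<close> and \<open>1\<close>, while a symbol \<open>k \<ge> 2\<close> is a marker visible only at scales finer than about
  \<open>1 / k\<close>. A one-sided sequence is admissible if every \<open>1\<close> following a marker \<open>k\<close> comes
  at most \<open>r\<^sup>2\<close> places after a run, itself after the marker, of \<open>r \<ge> k\<close> symbols other than \<open>1\<close>.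

  Words that are only seen up to markers smaller than \<open>n\<close> can be glued when each is preceded by
  about \<open>n + \<surd>L\<close> zeros, \<open>L\<close> being its length; this is sublinear for each \<open>n\<close>, whence weak
  specification. For almost specification, one fixed coarse scale allows fewer than \<open>N\<close> mistakes in
  a block of length \<open>N\<close>. Let a block that must carry a marker \<open>k \<ge> 2 N\<close> be followed by many coarse
  blocks \<open>1\<^sup>N\<close>. A run of length at least \<open>2 N\<close> inside the coarse part would contain a whole
  block, so every \<open>1\<close> there relies on a run that starts in the marker block. The length of such a
  run is bounded independently of the number of coarse blocks, a contradiction.\<close>

section \<open>The space\<close>

text \<open>Symbols from \<open>n\<close> on are identified with their limit \<open>0\<close>, so
  each scale sees only a finite alphabet.\<close>

definition trunc :: "nat \<Rightarrow> nat \<Rightarrow> nat" where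
  "trunc n s = (if s < n then s else 0)"

definition agree :: "nat \<Rightarrow> (nat \<Rightarrow> nat) \<Rightarrow> (nat \<Rightarrow> nat) \<Rightarrow> bool" where
  "agree n x y \<longleftrightarrow> (\<forall>i<n. trunc n (x i) = trunc n (y i))"

text \<open>For distinct sequences the denominator is positive, since \<open>agree 0 x y\<close>
  always holds.\<close>

definition seq_dist :: "(nat \<Rightarrow> nat) \<Rightarrow> (nat \<Rightarrow> nat) \<Rightarrow> real" where
  "seq_dist x y = (if x = y then 0 else 1 / real (LEAST n. \<not> agree n x y))"

definition shift :: "(nat \<Rightarrow> nat) \<Rightarrow> nat \<Rightarrow> nat" where
  "shift x = (\<lambda>i. x (Suc i))"

text \<open>The quadratic reach lets a run of about square-root length serve a whole segment, which
  keeps gaps sublinear. By \<open>p \<le> a\<close> the run may begin at the marker itself.\<close>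

definition covered :: "(nat \<Rightarrow> nat) \<Rightarrow> nat \<Rightarrow> nat \<Rightarrow> nat \<Rightarrow> bool" where
  "covered x k p q \<longleftrightarrow>
     (\<exists>a r. p \<le> a \<and> k \<le> r \<and> a + r \<le> q \<and> q \<le> a + r + r\<^sup>2 \<and> (\<forall>t\<in>{a..<a + r}. x t \<noteq> 1))"

definition marker_space :: "(nat \<Rightarrow> nat) set" where
  "marker_space = {x. \<forall>p q. p < q \<and> 2 \<le> x p \<and> x q = 1 \<longrightarrow> covered x (x p) p q}"

section \<open>Agreement at finite scales and the metric\<close>

lemma agree_refl [simp]: "agree n x x"
  by (simp add: agree_def)

lemma agree_sym: "agree n x y \<longleftrightarrow> agree n y x"
  by (auto simp: agree_def)

lemma agree_trans: "agree n x y \<Longrightarrow> agree n y z \<Longrightarrow> agree n x z"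
  by (auto simp: agree_def)

lemma trunc_trunc: "m \<le> n \<Longrightarrow> trunc m (trunc n s) = trunc m s"
  by (auto simp: trunc_def)

lemma agree_antimono: "agree n x y \<Longrightarrow> m \<le> n \<Longrightarrow> agree m x y"
  unfolding agree_def by (metis trunc_trunc order_less_le_trans)

lemma agree_all_imp_eq:
  assumes "\<And>n. agree n x y"
  shows "x = y"
proof
  fix i
  define n where "n = Suc (max i (max (x i) (y i)))"
  have "i < n" "x i < n" "y i < n"
    by (auto simp: n_def)
  with assms[of n] show "x i = y i"
    by (auto simp: agree_def trunc_def split: if_splits)
qed

text \<open>Agreement passes to smaller scales, so for distinct sequences it holds exactly below the
  first failure \<open>l\<close>. Metric statements are reduced to agreement in this way.\<close>

lemma seq_dist_less_iff:
  assumes "n \<ge> 1"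
  shows "seq_dist x y < 1 / real n \<longleftrightarrow> agree n x y"
proof (cases "x = y")
  case True
  with assms show ?thesis by (simp add: seq_dist_def)
next
  case False
  define l where "l = (LEAST n. \<not> agree n x y)"
  obtain n0 where "\<not> agree n0 x y"
    using False agree_all_imp_eq by blast
  then have l: "\<not> agree l x y"
    unfolding l_def by (rule LeastI)
  then have "l > 0"
    by (auto simp: agree_def intro: gr0I)
  have "agree n x y \<longleftrightarrow> n < l"
    using l agree_antimono not_less_Least[of n "\<lambda>n. \<not> agree n x y"]
    unfolding l_def by (meson not_le_imp_less)
  moreover have "1 / real l < 1 / real n \<longleftrightarrow> n < l"
    using assms \<open>l > 0\<close> by (simp add: field_simps)
  ultimately show ?thesis
    using False by (simp add: seq_dist_def l_def)
qed

lemma agree_imp_seq_dist_le: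
  assumes "n \<ge> 1" "1 / real n \<le> \<epsilon>" "agree n x y"
  shows "seq_dist x y \<le> \<epsilon>"
  using iffD2[OF seq_dist_less_iff[OF assms(1)] assms(3)] assms(2) by linarith

lemma seq_dist_le_imp_agree:
  assumes "n \<ge> 1" "\<epsilon> < 1 / real n" "seq_dist x y \<le> \<epsilon>"
  shows "agree n x y"
  using seq_dist_less_iff[OF assms(1)] assms by fastforce

lemma Metric_space_seq_dist: "Metric_space X seq_dist"
proof
  fix x y z
  show "0 \<le> seq_dist x y"
    by (simp add: seq_dist_def)
  show "seq_dist x y = seq_dist y x"
    by (simp add: seq_dist_def agree_sym[of _ x y] eq_commute[of x y])
  show "seq_dist x y = 0 \<longleftrightarrow> x = y"
  proof
    assume *: "seq_dist x y = 0"
    have "agree n x y" for n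
    proof (rule agree_antimono)
      show "agree (Suc n) x y"
        using seq_dist_less_iff[of "Suc n" x y] * by simp
    qed simp
    then show "x = y" by (rule agree_all_imp_eq)
  qed (simp add: seq_dist_def)
  show "seq_dist x z \<le> seq_dist x y + seq_dist y z"
  proof (rule ccontr)
    assume *: "\<not> ?thesis"
    have nonneg: "seq_dist u v \<ge> 0" for u v
      by (simp add: seq_dist_def)
    have "x \<noteq> z"
      using * nonneg[of x y] nonneg[of y z] by (auto simp: seq_dist_def[of x z])
    \<comment> \<open>If the triangle inequality failed, both shorter distances would lie below
      \<open>1 / real l\<close>; transitivity of \<open>agree l\<close> would then contradict the
      choice of \<open>l\<close>.\<close>
    define l where "l = (LEAST n. \<not> agree n x z)"
    have xz: "seq_dist x z = 1 / real l"
      using \<open>x \<noteq> z\<close> by (simp add: seq_dist_def l_def)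
    then have "l \<ge> 1"
      using * nonneg[of x y] nonneg[of y z] by (cases l) auto
    have "seq_dist x y < 1 / real l" "seq_dist y z < 1 / real l"
      using * nonneg[of x y] nonneg[of y z] xz by linarith+
    then have "agree l x z"
      using seq_dist_less_iff[OF \<open>l \<ge> 1\<close>] agree_trans by blast
    then show False
      using seq_dist_less_iff[OF \<open>l \<ge> 1\<close>, of x z] xz by simp
  qed
qed

section \<open>Completeness and total boundedness\<close>

interpretation M: Metric_space marker_space seq_dist
  by (rule Metric_space_seq_dist)

lemma ex_inverse_le: "0 < (\<epsilon>::real) \<Longrightarrow> \<exists>n\<ge>1. 1 / real n \<le> \<epsilon>"
  by (metis One_nat_def Suc_leI inverse_eq_divide less_imp_le real_arch_inverse
      bot_nat_0.not_eq_extremum)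

lemma MCauchy_agree:
  assumes "M.MCauchy \<sigma>"
  shows "\<exists>N. \<forall>m\<ge>N. \<forall>m'\<ge>N. agree n (\<sigma> m) (\<sigma> m')"
proof -
  have "1 / real (Suc n) > 0" by simp
  then obtain N where "\<forall>m m'. N \<le> m \<longrightarrow> N \<le> m' \<longrightarrow> seq_dist (\<sigma> m) (\<sigma> m') < 1 / real (Suc n)"
    using assms unfolding M.MCauchy_def by blast
  then have "agree (Suc n) (\<sigma> m) (\<sigma> m')" if "m \<ge> N" "m' \<ge> N" for m m'
    using that seq_dist_less_iff[of "Suc n"] by simp
  then show ?thesis
    by (meson agree_antimono le_SucI order_refl)
qed

text \<open>Runs depend only on where the letter \<open>1\<close> occurs before \<open>q\<close>;
  this lets coverage pass to limits.\<close>

lemma covered_cong: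
  assumes "\<And>t. t < q \<Longrightarrow> x t = 1 \<longleftrightarrow> y t = 1"
  shows "covered x k p q \<longleftrightarrow> covered y k p q"
proof -
  have "covered y k p q" if "covered x k p q" "\<And>t. t < q \<Longrightarrow> x t = 1 \<longleftrightarrow> y t = 1"
    for x y :: "nat \<Rightarrow> nat"
  proof -
    obtain a r where "p \<le> a" "k \<le> r" "a + r \<le> q" "q \<le> a + r + r\<^sup>2" "\<forall>t\<in>{a..<a + r}. x t \<noteq> 1"
      using \<open>covered x k p q\<close> unfolding covered_def by blast
    moreover from this have "\<forall>t\<in>{a..<a + r}. y t \<noteq> 1"
      using that(2) by auto
    ultimately show ?thesis
      unfolding covered_def by blast
  qed
  from this[of x y] this[of y x] assms show ?thesis by blast
qed

lemma agree_value_iff: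
  assumes "agree n x y" "i < n" "s < n" "s > 0"
  shows "x i = s \<longleftrightarrow> y i = s"
  using assms unfolding agree_def trunc_def by (metis less_numeral_extra(3))

text \<open>A violation involves finitely many symbols, hence is visible at any scale exceeding both
  \<open>q\<close> and the marker \<open>x p\<close>.\<close>

lemma marker_space_closed:
  assumes "\<And>n. \<exists>y\<in>marker_space. agree n y x"
  shows "x \<in> marker_space"
  unfolding marker_space_def
proof (intro CollectI allI impI)
  fix p q
  assume pq: "p < q \<and> 2 \<le> x p \<and> x q = 1"
  define n where "n = Suc (max q (x p))"
  obtain y where y: "y \<in> marker_space" "agree n y x"
    using assms by blast
  have n: "q < n" "x p < n" "p < n" "1 < n"
    using pq by (auto simp: n_def)
  have one: "y t = 1 \<longleftrightarrow> x t = 1" if "t \<le> q" for t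
    using agree_value_iff[OF y(2), of t 1] that n by simp
  have "y p = x p"
    using agree_value_iff[OF y(2), of p "x p"] n pq by simp
  moreover have "y q = 1"
    using one pq by simp
  ultimately have "covered y (x p) p q"
    using y(1) pq unfolding marker_space_def by force
  then show "covered x (x p) p q"
    using covered_cong[of q x y] one by auto
qed

lemma mcomplete_marker_space: "M.mcomplete"
  unfolding M.mcomplete_def
proof (intro allI impI)
  fix \<sigma> assume \<sigma>: "M.MCauchy \<sigma>"
  then have \<sigma>_in: "\<sigma> m \<in> marker_space" for m
    unfolding M.MCauchy_def by auto
  obtain N where N: "agree n (\<sigma> m) (\<sigma> m')" if "m \<ge> N n" "m' \<ge> N n" for n m m'
    using MCauchy_agree[OF \<sigma>] by metis
  \<comment> \<open>A coordinate either shows a nonzero symbol at some scale, which is then its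
    limit, or stays invisible at every scale and tends to \<open>0\<close>.\<close>
  define l where "l i = (if \<exists>n>i. trunc n (\<sigma> (N n) i) \<noteq> 0
    then (SOME s. s \<noteq> 0 \<and> (\<exists>n>i. trunc n (\<sigma> (N n) i) = s)) else 0)" for i
  have l: "trunc n (\<sigma> m i) = trunc n (l i)" if "i < n" "m \<ge> N n" for n m i
  proof (cases "\<exists>n>i. trunc n (\<sigma> (N n) i) \<noteq> 0")
    case True
    then have "\<exists>s. s \<noteq> 0 \<and> (\<exists>n>i. trunc n (\<sigma> (N n) i) = s)" by blast
    from someI_ex[OF this] True have "l i \<noteq> 0 \<and> (\<exists>n>i. trunc n (\<sigma> (N n) i) = l i)"
      by (simp add: l_def)
    then obtain n' where n': "l i \<noteq> 0" "n' > i" "trunc n' (\<sigma> (N n') i) = l i" by blast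
    \<comment> \<open>Beyond both thresholds a single term can be read at the scales
      \<open>n\<close> and \<open>n'\<close> together.\<close>
    define M where "M = max (N n) (N n')"
    have "trunc n (\<sigma> m i) = trunc n (\<sigma> M i)"
      using N[of n m M] that unfolding M_def agree_def by auto
    moreover have "trunc n' (\<sigma> M i) = l i"
      using N[of n' M "N n'"] n' unfolding M_def agree_def by auto
    ultimately show ?thesis
      using \<open>l i \<noteq> 0\<close> by (auto simp: trunc_def split: if_splits)
  next
    case False
    then have "trunc n (\<sigma> (N n) i) = 0" "l i = 0"
      using that by (auto simp: l_def)
    moreover have "trunc n (\<sigma> m i) = trunc n (\<sigma> (N n) i)"
      using N[of n m "N n"] that unfolding agree_def by auto
    ultimately show ?thesis by (simp add: trunc_def)
  qed
  then have agree: "agree n (\<sigma> m) l" if "m \<ge> N n" for n m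
    using that by (simp add: agree_def)
  have "l \<in> marker_space"
    using marker_space_closed[of l] \<sigma>_in agree by blast
  moreover have "\<exists>N. \<forall>m\<ge>N. seq_dist (\<sigma> m) l < \<epsilon>" if "\<epsilon> > 0" for \<epsilon>
  proof -
    obtain n where n: "n \<ge> 1" "1 / real n \<le> \<epsilon>"
      using ex_inverse_le[OF \<open>\<epsilon> > 0\<close>] by blast
    have "seq_dist (\<sigma> m) l < \<epsilon>" if "m \<ge> N n" for m
      using seq_dist_less_iff[OF n(1), of "\<sigma> m" l] agree[OF that] n(2) by linarith
    then show ?thesis by blast
  qed
  ultimately show "\<exists>x. limitin M.mtopology \<sigma> x sequentially"
    using \<sigma>_in unfolding M.limit_metric_sequentially by blast
qed

text \<open>Scale \<open>n\<close> sees only a truncated prefix of length \<open>n\<close>. There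
  are finitely many of these, and one representative of each that occurs gives a finite net.\<close>

lemma mtotally_bounded_marker_space: "M.mtotally_bounded marker_space"
  unfolding M.mtotally_bounded_def
proof (intro allI impI)
  fix \<epsilon> :: real assume "\<epsilon> > 0"
  then obtain n where n: "n \<ge> 1" "1 / real n \<le> \<epsilon>"
    using ex_inverse_le by blast
  define code where "code x = map (\<lambda>i. trunc n (x i)) [0..<n]" for x :: "nat \<Rightarrow> nat"
  have "code ` marker_space \<subseteq> {xs. set xs \<subseteq> {..<n} \<and> length xs = n}"
    using n(1) by (auto simp: code_def trunc_def)
  then have "finite (code ` marker_space)"
    using finite_lists_length_eq[of "{..<n}" n] finite_subset by blast
  then obtain K where K: "finite K" "K \<subseteq> marker_space" "code ` marker_space = code ` K"
    by (metis finite_subset_image order_refl)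
  have "\<exists>y\<in>K. seq_dist y x < \<epsilon>" if "x \<in> marker_space" for x
  proof -
    obtain y where "y \<in> K" "code y = code x"
      using K(3) \<open>x \<in> marker_space\<close> by (metis (no_types, lifting) image_iff)
    then have "agree n y x"
      unfolding agree_def code_def by simp
    then have "seq_dist y x < \<epsilon>"
      using seq_dist_less_iff[OF n(1), of y x] n(2) by linarith
    with \<open>y \<in> K\<close> show ?thesis by blast
  qed
  then show "\<exists>K. finite K \<and> K \<subseteq> marker_space \<and> marker_space \<subseteq> (\<Union>x\<in>K. M.mball x \<epsilon>)"
    using K(1,2) by (intro exI[of _ K]) (auto simp: subset_iff)
qed

section \<open>The shift map\<close>

lemma shift_marker_space:
  assumes "x \<in> marker_space"
  shows "shift x \<in> marker_space"
  unfolding marker_space_def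
proof (intro CollectI allI impI)
  fix p q
  assume pq: "p < q \<and> 2 \<le> shift x p \<and> shift x q = 1"
  then have "covered x (x (Suc p)) (Suc p) (Suc q)"
    using assms unfolding marker_space_def shift_def by auto
  then obtain a r where ar: "Suc p \<le> a" "x (Suc p) \<le> r" "a + r \<le> Suc q" "Suc q \<le> a + r + r\<^sup>2"
      "\<forall>t\<in>{a..<a + r}. x t \<noteq> 1"
    unfolding covered_def by blast
  \<comment> \<open>A run never starts before its marker, so it avoids position \<open>0\<close> and
    survives deletion of the first symbol.\<close>
  obtain a' where "a = Suc a'"
    using ar(1) by (cases a) auto
  moreover from this ar(5) have "\<forall>t\<in>{a'..<a' + r}. x (Suc t) \<noteq> 1"
    by auto
  ultimately show "covered (shift x) (shift x p) p q"
    using ar(1-4) unfolding covered_def shift_def by (intro exI[of _ a'] exI[of _ r]) auto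
qed

lemma agree_shift: "agree (Suc n) x y \<Longrightarrow> agree n (shift x) (shift y)"
  unfolding agree_def shift_def by (metis Suc_less_eq le_Suc_eq order_refl trunc_trunc)

lemma shift_funpow: "(shift ^^ j) x = (\<lambda>i. x (i + j))"
  by (induction j arbitrary: x) (auto simp: funpow_swap1 shift_def)

lemma dynamical_system_marker_space: "dynamical_system marker_space seq_dist shift"
proof -
  have "\<exists>\<delta>>0. \<forall>y. y \<in> marker_space \<and> seq_dist x y < \<delta> \<longrightarrow> seq_dist (shift x) (shift y) < \<epsilon>"
    if "\<epsilon> > 0" for x \<epsilon>
  proof -
    obtain n where n: "n \<ge> 1" "1 / real n \<le> \<epsilon>"
      using ex_inverse_le[OF \<open>\<epsilon> > 0\<close>] by blast
    have "seq_dist (shift x) (shift y) < \<epsilon>" if "seq_dist x y < 1 / real (Suc n)" for y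
    proof -
      have "agree n (shift x) (shift y)"
        using seq_dist_less_iff[of "Suc n" x y] that agree_shift by simp
      then show ?thesis
        using seq_dist_less_iff[OF n(1), of "shift x" "shift y"] n(2) by linarith
    qed
    then show ?thesis
      by (intro exI[of _ "1 / real (Suc n)"]) auto
  qed
  then have "continuous_map M.mtopology M.mtopology shift"
    unfolding M.metric_continuous_map[OF Metric_space_seq_dist]
    using shift_marker_space by blast
  then show ?thesis
    unfolding dynamical_system_def M.compact_space_eq_mcomplete_mtotally_bounded
    using Metric_space_seq_dist mcomplete_marker_space mtotally_bounded_marker_space by blast
qed

section \<open>Weak specification\<close>

lemma interleaved_mono:
  assumes "interleaved k a b" "1 \<le> i" "i \<le> j" "j \<le> k"
  shows "b i \<le> b j"
  using assms(3,4)
proof (induction j rule: dec_induct)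
  case (step j)
  then have "b (Suc j - 1) < a (Suc j)" "a (Suc j) \<le> b (Suc j)"
    using assms(1,2) unfolding interleaved_def by (auto dest!: bspec[of _ _ "Suc j"])
  with step show ?case by simp
qed simp

text \<open>Segments are extended by \<open>n\<close> because scale \<open>n\<close> at time
  \<open>b i\<close> looks at \<open>n\<close> symbols. Everything between the extended segments is
  filled with zeros, and the last \<open>r i\<close> of them before \<open>a i\<close> license the
  ones of segment \<open>i\<close> against markers of earlier segments.\<close>

lemma glue:
  assumes x: "\<And>i. i \<in> {1..k} \<Longrightarrow> x i \<in> marker_space"
    and ab: "interleaved k a b"
    and gap: "\<And>i. i \<in> {2..k} \<Longrightarrow> b (i - 1) + n + r i \<le> a i"
    and r: "\<And>i. i \<in> {2..k} \<Longrightarrow> n \<le> r i \<and> b i + n \<le> a i + (r i)\<^sup>2"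
  shows "\<exists>y\<in>marker_space. \<forall>i\<in>{1..k}. \<forall>t\<in>{a i..<b i + n}. y t = trunc n (x i t)"
proof -
  \<comment> \<open>The choice of \<open>i\<close> is harmless: the extended segments are disjoint,
    as \<open>unique\<close> shows.\<close>
  define y where "y t = (if \<exists>i\<in>{1..k}. t \<in> {a i..<b i + n}
    then trunc n (x (SOME i. i \<in> {1..k} \<and> t \<in> {a i..<b i + n}) t) else 0)" for t
  have before: "b i + n + r j \<le> a j" if "1 \<le> i" "i < j" "j \<le> k" for i j
  proof -
    have "b i \<le> b (j - 1)"
      by (rule interleaved_mono[OF ab]) (use that in linarith)+
    then show ?thesis
      using gap[of j] that by simp
  qed
  have a_le: "a i \<le> b i" if "i \<in> {1..k}" for i
    using ab that unfolding interleaved_def by blast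
  have unique: "i = j" if "i \<in> {1..k}" "j \<in> {1..k}" "t \<in> {a i..<b i + n}" "t \<in> {a j..<b j + n}"
    for i j t
  proof -
    have "\<not> i < j" "\<not> j < i"
      using before[of i j] before[of j i] that by auto
    then show ?thesis by simp
  qed
  have y_seg: "y t = trunc n (x i t)" if "i \<in> {1..k}" "t \<in> {a i..<b i + n}" for i t
  proof -
    have "(SOME i. i \<in> {1..k} \<and> t \<in> {a i..<b i + n}) = i"
      using that unique by (intro some_equality) blast+
    with that show ?thesis unfolding y_def by auto
  qed
  have y_gap: "y t = 0" if "j \<in> {2..k}" "t \<in> {a j - r j..<a j}" for j t
  proof -
    have "t \<notin> {a i..<b i + n}" if "i \<in> {1..k}" for i
    proof (cases "i < j")
      case True
      then have "b i + n + r j \<le> a j"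
        using before[of i j] \<open>j \<in> {2..k}\<close> that by simp
      with \<open>t \<in> _\<close> show ?thesis by auto
    next
      case False
      then have "a j \<le> a i"
        using before[of j i] a_le[of j] that \<open>j \<in> {2..k}\<close> by (cases "i = j") auto
      with \<open>t \<in> _\<close> show ?thesis by auto
    qed
    then show ?thesis unfolding y_def by auto
  qed
  have y_nz: "\<exists>i\<in>{1..k}. t \<in> {a i..<b i + n} \<and> y t = x i t \<and> x i t < n" if nz: "y t \<noteq> 0" for t
  proof -
    obtain i where "i \<in> {1..k}" "t \<in> {a i..<b i + n}"
      using nz unfolding y_def by metis
    with y_seg[of i t] nz show ?thesis
      by (intro bexI[of _ i]) (auto simp: trunc_def split: if_splits)
  qed
  have "y \<in> marker_space"
    unfolding marker_space_def
  proof (intro CollectI allI impI)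
    fix p q
    assume pq: "p < q \<and> 2 \<le> y p \<and> y q = 1"
    obtain i where i: "i \<in> {1..k}" "p \<in> {a i..<b i + n}" "y p = x i p" "x i p < n"
      using y_nz[of p] pq by auto
    obtain j where j: "j \<in> {1..k}" "q \<in> {a j..<b j + n}" "y q = x j q"
      using y_nz[of q] pq by auto
    have "\<not> j < i"
      using before[of j i] i j pq by auto
    then consider "i = j" | "i < j" by linarith
    then show "covered y (y p) p q"
    proof cases
      assume "i = j"
      then have "covered (x i) (x i p) p q"
        using x[OF i(1)] pq i j unfolding marker_space_def by auto
      then obtain s l where sl: "p \<le> s" "x i p \<le> l" "s + l \<le> q" "q \<le> s + l + l\<^sup>2"
          "\<forall>t\<in>{s..<s + l}. x i t \<noteq> 1"
        unfolding covered_def by blast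
      \<comment> \<open>The run lies between \<open>p\<close> and \<open>q\<close>, hence inside one
        segment, and truncation never creates a \<open>1\<close>.\<close>
      have "y t \<noteq> 1" if "t \<in> {s..<s + l}" for t
      proof -
        have "t \<in> {a i..<b i + n}"
          using that sl i j \<open>i = j\<close> by auto
        with sl(5) that y_seg[OF i(1)] show ?thesis
          by (auto simp: trunc_def)
      qed
      with sl i(3) show ?thesis
        unfolding covered_def by (intro exI[of _ s] exI[of _ l]) auto
    next
      assume "i < j"
      \<comment> \<open>The zeros before segment \<open>j\<close> form the run: markers surviving
        truncation are below \<open>n \<le> r j\<close>, and \<open>(r j)\<^sup>2\<close> reaches
        the end of the extended segment.\<close>
      then have "j \<in> {2..k}" using i(1) j(1) by auto
      have "b i + n + r j \<le> a j"
        using before[of i j] \<open>i < j\<close> i(1) j(1) by simp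
      moreover have "y t \<noteq> 1" if "t \<in> {a j - r j..<a j - r j + r j}" for t
        using y_gap[OF \<open>j \<in> {2..k}\<close>, of t] that \<open>b i + n + r j \<le> a j\<close> by auto
      ultimately show ?thesis
        unfolding covered_def using i j r[OF \<open>j \<in> {2..k}\<close>]
        by (intro exI[of _ "a j - r j"] exI[of _ "r j"]) auto
    qed
  qed
  with y_seg show ?thesis by blast
qed

lemma weak_specification_marker_space: "weak_specification marker_space seq_dist shift"
  unfolding weak_specification_def
proof (intro allI impI)
  fix \<epsilon> :: real assume "\<epsilon> > 0"
  then obtain n where n: "n \<ge> 1" "1 / real n \<le> \<epsilon>"
    using ex_inverse_le by blast
  \<comment> \<open>The summand \<open>n\<close> dominates all visible markers, and the rounded root
    makes the square at least \<open>L + n\<close>.\<close>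
  define r where "r L = n + nat \<lceil>sqrt (real L)\<rceil>" for L
  have r_sq: "L + n \<le> (r L)\<^sup>2" for L
  proof -
    define s where "s = nat \<lceil>sqrt (real L)\<rceil>"
    have "sqrt (real L) \<le> real s"
      by (simp add: s_def real_nat_ceiling_ge)
    then have "real L \<le> (real s)\<^sup>2"
      by (rule sqrt_le_D)
    then have "L \<le> s\<^sup>2"
      by (metis of_nat_le_iff of_nat_power)
    moreover have "n \<le> n\<^sup>2"
      using n(1) by (simp add: power2_eq_square)
    ultimately show ?thesis
      by (simp add: r_def power2_sum flip: s_def)
  qed
  \<comment> \<open>The extra \<open>n\<close> pays for the extension of the preceding segment;
    \<open>r L\<close> is the run of zeros.\<close>
  define M where "M L = n + r L" for L
  have "(\<lambda>L. real (M L) / real L) \<longlonglongrightarrow> 0"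
  proof (rule tendsto_sandwich[where f = "\<lambda>_. 0"])
    \<comment> \<open>Rounding up costs the \<open>1\<close> in \<open>2 * n + 1\<close>. For
      \<open>L = 0\<close> both sides vanish, since division by zero gives \<open>0\<close>.\<close>
    have "real (M L) / real L \<le> real (2 * n + 1) * inverse (real L) + inverse (sqrt (real L))" for L
    proof (cases "L = 0")
      case False
      have "real (M L) \<le> real (2 * n + 1) + sqrt (real L)"
        unfolding M_def r_def by (simp add: of_nat_ceiling) linarith
      then have "real (M L) / real L \<le> (real (2 * n + 1) + sqrt (real L)) / real L"
        by (intro divide_right_mono) auto
      also have "\<dots> = real (2 * n + 1) * inverse (real L) + inverse (sqrt (real L))"
        using False by (simp add: field_simps real_div_sqrt flip: real_sqrt_mult)
      finally show ?thesis .
    qed simp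
    then show "\<forall>\<^sub>F L in sequentially. real (M L) / real L
        \<le> real (2 * n + 1) * inverse (real L) + inverse (sqrt (real L))"
      by simp
    have "(\<lambda>L. real (2 * n + 1) * inverse (real L) + inverse (sqrt (real L))) \<longlonglongrightarrow> real (2 * n + 1) * 0 + sqrt 0"
      unfolding real_sqrt_inverse[symmetric]
      by (intro tendsto_intros lim_inverse_n)
    then show "(\<lambda>L. real (2 * n + 1) * inverse (real L) + inverse (sqrt (real L))) \<longlonglongrightarrow> 0"
      by simp
  qed auto
  moreover have "M L \<ge> 1" for L
    using n(1) by (simp add: M_def)
  moreover have "\<exists>y\<in>marker_space. \<forall>i\<in>{1..k}. \<forall>j\<in>{a i..b i}.
      seq_dist ((shift ^^ j) y) ((shift ^^ j) (x i)) \<le> \<epsilon>"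
    if "\<forall>i\<in>{1..k}. x i \<in> marker_space" and ab: "interleaved k a b"
      and gap: "\<forall>i\<in>{2..k}. M (b i - a i) \<le> a i - b (i - 1)" for k x a b
  proof -
    have "\<exists>y\<in>marker_space. \<forall>i\<in>{1..k}. \<forall>t\<in>{a i..<b i + n}. y t = trunc n (x i t)"
    proof (rule glue[where r = "\<lambda>i. r (b i - a i)"])
      fix i assume i: "i \<in> {2..k}"
      have "b (i - 1) < a i" "a i \<le> b i"
        using i ab by (auto simp: interleaved_def)
      then show "b (i - 1) + n + r (b i - a i) \<le> a i"
        using gap i by (force simp: M_def)
      show "n \<le> r (b i - a i) \<and> b i + n \<le> a i + (r (b i - a i))\<^sup>2"
        using r_sq[of "b i - a i"] \<open>a i \<le> b i\<close> by (simp add: r_def)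
    qed (use that in auto)
    then obtain y where y: "y \<in> marker_space"
      "\<And>i t. i \<in> {1..k} \<Longrightarrow> t \<in> {a i..<b i + n} \<Longrightarrow> y t = trunc n (x i t)"
      by blast
    have "agree n ((shift ^^ j) y) ((shift ^^ j) (x i))" if "i \<in> {1..k}" "j \<in> {a i..b i}" for i j
      using y(2)[OF that(1)] that(2) by (auto simp: agree_def shift_funpow trunc_trunc)
    then show ?thesis
      using y(1) agree_imp_seq_dist_le[OF n] by blast
  qed
  ultimately show "\<exists>M::nat \<Rightarrow> nat. (\<forall>n. M n \<ge> 1) \<and> (\<lambda>n. real (M n) / real n) \<longlonglongrightarrow> 0 \<and>
    (\<forall>k\<ge>1. \<forall>x a b. (\<forall>i\<in>{1..k}. x i \<in> marker_space) \<and> interleaved k a b \<and>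
      (\<forall>i\<in>{2..k}. a i - b (i - 1) \<ge> M (b i - a i)) \<longrightarrow>
      (\<exists>y\<in>marker_space. \<forall>i\<in>{1..k}. \<forall>j\<in>{a i..b i}.
        seq_dist ((shift ^^ j) y) ((shift ^^ j) (x i)) \<le> \<epsilon>))"
    by (intro exI[of _ M]) blast
qed

section \<open>Failure of almost specification\<close>

text \<open>Since \<open>g m \<epsilon> / m\<close> tends to \<open>0\<close>, the set under
  \<open>LEAST\<close> is nonempty, so the threshold has its defining property.\<close>

lemma mistake_threshold:
  assumes "mistake_function \<epsilon>0 g" "0 < \<epsilon>" "\<epsilon> < \<epsilon>0"
  defines "n \<equiv> mistake_threshold g \<epsilon>"
  shows "n \<ge> 1" "real (g n \<epsilon>) < real n * \<epsilon>"
proof -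
  have "(\<lambda>m. real (g m \<epsilon>) / real m) \<longlonglongrightarrow> 0"
    using assms(1-3) unfolding mistake_function_def by auto
  then have "\<forall>\<^sub>F m in sequentially. real (g m \<epsilon>) / real m < \<epsilon>"
    using \<open>0 < \<epsilon>\<close> by (rule order_tendstoD)
  then obtain m0 where m0: "\<And>m. m \<ge> m0 \<Longrightarrow> real (g m \<epsilon>) / real m < \<epsilon>"
    unfolding eventually_sequentially by blast
  have "real (g m \<epsilon>) < real m * \<epsilon>" if "m \<ge> max 1 m0" for m
    using m0[of m] that by (simp add: field_simps)
  then have "\<exists>n. n \<ge> 1 \<and> (\<forall>m\<ge>n. real (g m \<epsilon>) < real m * \<epsilon>)"
    by (intro exI[of _ "max 1 m0"]) auto
  then have "n \<ge> 1 \<and> (\<forall>m\<ge>n. real (g m \<epsilon>) < real m * \<epsilon>)"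
    unfolding n_def mistake_threshold_def by (rule LeastI_ex)
  then show "n \<ge> 1" "real (g n \<epsilon>) < real n * \<epsilon>"
    by blast+
qed

text \<open>Fewer than \<open>n * \<epsilon> \<le> n\<close> mistakes leave at least one correct
  position, and there scale \<open>s + 1\<close> shows the symbol \<open>s\<close> exactly.\<close>

lemma mistake_ball_threshold:
  assumes g: "mistake_function \<epsilon>0 g" "0 < \<epsilon>" "\<epsilon> < \<epsilon>0" "\<epsilon> < 1 / real (Suc s)" and "s \<ge> 1"
    and y: "y \<in> mistake_ball X seq_dist shift g (mistake_threshold g \<epsilon>) (\<lambda>_. s) \<epsilon>"
  shows "\<exists>i<mistake_threshold g \<epsilon>. y i = s"
proof -
  define n where "n = mistake_threshold g \<epsilon>"
  obtain \<Lambda> where \<Lambda>: "\<Lambda> \<subseteq> {0..<n}" "card ({0..<n} - \<Lambda>) \<le> g n \<epsilon>"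
    "\<And>i. i \<in> \<Lambda> \<Longrightarrow> seq_dist ((shift ^^ i) (\<lambda>_. s)) ((shift ^^ i) y) \<le> \<epsilon>"
    using y unfolding mistake_ball_def n_def by blast
  have "1 / real (Suc s) \<le> 1" by simp
  then have "\<epsilon> \<le> 1"
    using g(4) by linarith
  then have "real n * \<epsilon> \<le> real n"
    by (simp add: mult_left_le)
  then have "g n \<epsilon> < n"
    using mistake_threshold(2)[OF g(1-3)] unfolding n_def by linarith
  then obtain i where i: "i \<in> \<Lambda>"
    using \<Lambda>(2) by fastforce
  have "agree (Suc s) ((shift ^^ i) (\<lambda>_. s)) ((shift ^^ i) y)"
    using seq_dist_le_imp_agree[OF _ g(4) \<Lambda>(3)[OF i]] by simp
  from agree_value_iff[OF this, of 0 s] have "y i = s"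
    using \<open>s \<ge> 1\<close> by (simp add: shift_funpow)
  with i \<Lambda>(1) show ?thesis
    unfolding n_def by (intro exI[of _ i]) auto
qed

text \<open>The run covering a \<open>1\<close> in the last block has length at least
  \<open>2 * n\<close> but contains no whole block. It must therefore start before \<open>l\<close>
  and end before \<open>l + n\<close>, which bounds its reach independently of
  \<open>N\<close>.\<close>

lemma marker_space_ones_after_marker:
  assumes z: "z \<in> marker_space" and p: "p < l" "2 \<le> z p" "2 * n \<le> z p"
    and ones: "\<And>j. j \<le> N \<Longrightarrow> \<exists>i<n. z (l + j * n + i) = 1"
  shows "N * n \<le> (l + n) + (l + n)\<^sup>2"
proof -
  obtain i where i: "i < n" "z (l + N * n + i) = 1"
    using ones by blast
  define q where "q = l + N * n + i"
  have "covered z (z p) p q"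
    using z p i unfolding marker_space_def q_def by auto
  then obtain a r where ar: "2 * n \<le> r" "a + r \<le> q" "q \<le> a + r + r\<^sup>2" "\<forall>t\<in>{a..<a + r}. z t \<noteq> 1"
    using p(3) unfolding covered_def by (meson order_trans)
  have no_block: False if "a \<le> l + j * n" "l + j * n + n \<le> a + r" "j \<le> N" for j
  proof -
    obtain i' where "i' < n" "z (l + j * n + i') = 1"
      using ones[OF \<open>j \<le> N\<close>] by blast
    with ar(4) that(1,2) show False by auto
  qed
  have "a < l"
  proof (rule ccontr)
    assume "\<not> a < l"
    \<comment> \<open>The next block boundary after \<open>a\<close> is at most \<open>n\<close>
      away, so a run of length \<open>2 * n\<close> contains the block starting there.\<close>
    define j where "j = Suc ((a - l) div n)"
    have "n > 0" using i by simp
    have a: "a = l + (a - l) div n * n + (a - l) mod n"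
      using \<open>\<not> a < l\<close> by (metis add.assoc div_mult_mod_eq le_add_diff_inverse not_less)
    have "(a - l) mod n < n"
      using \<open>n > 0\<close> by simp
    moreover have "j * n = n + (a - l) div n * n"
      by (simp add: j_def)
    ultimately have 1: "a \<le> l + j * n" "l + j * n \<le> a + n"
      using a by linarith+
    then have 2: "l + j * n + n \<le> a + r"
      using ar(1) by simp
    have "j * n < Suc N * n"
      using 2 ar(2) i(1) unfolding q_def by simp
    then have "j \<le> N"
      by (metis less_Suc_eq_le mult_less_cancel2)
    with no_block 1(1) 2 show False by blast
  qed
  \<comment> \<open>Otherwise the run would contain block \<open>0\<close>.\<close>
  then have "a + r < l + n"
    using no_block[of 0] by fastforce
  moreover from this have "r\<^sup>2 \<le> (l + n)\<^sup>2"
    by (intro power_mono) auto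
  ultimately have "q \<le> (l + n) + (l + n)\<^sup>2"
    using ar(3) by linarith
  then show ?thesis
    unfolding q_def by linarith
qed

lemma const_marker_space: "(\<lambda>_. s) \<in> marker_space"
  by (auto simp: marker_space_def)

lemma not_almost_specification_marker_space: "\<not> almost_specification marker_space seq_dist shift"
proof
  assume "almost_specification marker_space seq_dist shift"
  then obtain \<epsilon>0 g where g: "mistake_function \<epsilon>0 g"
    and spec: "\<And>m \<epsilon> x a b. m \<ge> 1 \<Longrightarrow> \<forall>j\<in>{1..m}. \<epsilon> j \<in> {0<..<\<epsilon>0} \<Longrightarrow>
      \<forall>j\<in>{1..m}. x j \<in> marker_space \<Longrightarrow> interleaved m a b \<Longrightarrow>
      \<forall>j\<in>{1..m}. b j - a j + 1 \<ge> mistake_threshold g (\<epsilon> j) \<Longrightarrow>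
      \<exists>z\<in>marker_space. \<forall>j\<in>{1..m}.
        (shift ^^ a j) z \<in> mistake_ball marker_space seq_dist shift g (b j - a j + 1) (x j) (\<epsilon> j)"
    unfolding almost_specification_def by blast
  have "\<epsilon>0 > 0"
    using g unfolding mistake_function_def by blast
  \<comment> \<open>Below \<open>1 / 2\<close> the letter \<open>1\<close> is visible. This coarse
    scale fixes the block length \<open>n\<close> before the marker is chosen.\<close>
  define \<epsilon>c where "\<epsilon>c = min (\<epsilon>0 / 2) (1 / 3)"
  define n where "n = mistake_threshold g \<epsilon>c"
  have \<epsilon>c: "0 < \<epsilon>c" "\<epsilon>c < \<epsilon>0" "\<epsilon>c < 1 / real (Suc 1)"
    using \<open>\<epsilon>0 > 0\<close> unfolding \<epsilon>c_def by auto
  have n: "n \<ge> 1"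
    using mistake_threshold(1)[OF g \<epsilon>c(1,2)] by (simp add: n_def)
  \<comment> \<open>Fine enough, depending on \<open>n\<close>, to show the marker
    \<open>2 * n\<close>.\<close>
  define \<epsilon>f where "\<epsilon>f = min (\<epsilon>0 / 2) (1 / real (2 * n + 2))"
  define l where "l = mistake_threshold g \<epsilon>f"
  have "1 / real (2 * n + 2) < 1 / real (Suc (2 * n))"
    by (intro divide_strict_left_mono) auto
  then have \<epsilon>f: "0 < \<epsilon>f" "\<epsilon>f < \<epsilon>0" "\<epsilon>f < 1 / real (Suc (2 * n))"
    using \<open>\<epsilon>0 > 0\<close> unfolding \<epsilon>f_def by auto
  have l: "l \<ge> 1"
    using mistake_threshold(1)[OF g \<epsilon>f(1,2)] by (simp add: l_def)
  \<comment> \<open>One more than the bound on \<open>N * n\<close>, for the final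
    contradiction.\<close>
  define N where "N = Suc ((l + n) + (l + n)\<^sup>2)"
  define \<epsilon> where "\<epsilon> j = (if j = 1 then \<epsilon>f else \<epsilon>c)" for j :: nat
  \<comment> \<open>Constant sequences are admissible because none contains both a marker and a
    \<open>1\<close>.\<close>
  define x where "x j = (\<lambda>_::nat. if j = 1 then 2 * n else 1)" for j :: nat
  \<comment> \<open>A marker block of length \<open>l\<close> at the origin, then
    \<open>N + 1\<close> coarse blocks of length \<open>n\<close> without gaps; coarse block
    \<open>j\<close>, counted from \<open>0\<close>, has index \<open>j + 2\<close>.\<close>
  define a where "a j = (if j = 1 then 0 else l + (j - 2) * n)" for j :: nat
  define b where "b j = a j + (if j = 1 then l else n) - 1" for j :: nat
  have len: "b j - a j + 1 = mistake_threshold g (\<epsilon> j)" for j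
    using n l by (auto simp: b_def \<epsilon>_def simp flip: n_def l_def)
  have "interleaved (N + 2) a b"
    unfolding interleaved_def
  proof (intro conjI ballI)
    fix i assume "i \<in> {1..N + 2}"
    then show "a i \<le> b i"
      using n l by (auto simp: b_def)
  next
    fix i assume i: "i \<in> {2..N + 2}"
    then consider "i = 2" | j where "i = j + 3"
      by (metis One_nat_def Suc_eq_plus1 add.commute add_2_eq_Suc' atLeastAtMost_iff le_Suc_ex
          le_antisym not_less_eq_eq numeral_3_eq_3)
    then show "b (i - 1) < a i"
      using n l by cases (auto simp: b_def a_def)
  qed
  then have "\<exists>z\<in>marker_space. \<forall>j\<in>{1..N + 2}. (shift ^^ a j) z
      \<in> mistake_ball marker_space seq_dist shift g (b j - a j + 1) (x j) (\<epsilon> j)"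
    by (intro spec) (use \<epsilon>c \<epsilon>f const_marker_space in \<open>auto simp: len[simplified] \<epsilon>_def x_def\<close>)
  then obtain z where z: "z \<in> marker_space" and ball: "\<And>j. j \<in> {1..N + 2} \<Longrightarrow>
      (shift ^^ a j) z \<in> mistake_ball marker_space seq_dist shift g (mistake_threshold g (\<epsilon> j)) (x j) (\<epsilon> j)"
    unfolding len by blast
  have "z \<in> mistake_ball marker_space seq_dist shift g (mistake_threshold g \<epsilon>f) (\<lambda>_. 2 * n) \<epsilon>f"
    using ball[of 1] by (simp add: a_def x_def \<epsilon>_def)
  then obtain p where p: "p < l" "z p = 2 * n"
    using mistake_ball_threshold[OF g \<epsilon>f] n by (auto simp: l_def)
  have "\<exists>i<n. z (l + j * n + i) = 1" if "j \<le> N" for j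
  proof -
    have "(shift ^^ (l + j * n)) z
        \<in> mistake_ball marker_space seq_dist shift g (mistake_threshold g \<epsilon>c) (\<lambda>_. 1) \<epsilon>c"
      using ball[of "j + 2"] that by (simp add: a_def x_def \<epsilon>_def)
    from mistake_ball_threshold[OF g \<epsilon>c _ this] show ?thesis
      by (auto simp: shift_funpow add_ac n_def)
  qed
  then have "N * n \<le> (l + n) + (l + n)\<^sup>2"
    using marker_space_ones_after_marker[OF z p(1), of n N] p(2) n by auto
  moreover have "N \<le> N * n"
    using n by simp
  ultimately show False
    unfolding N_def by linarith
qed

theorem mainTheorem3:
  "\<exists>(X :: (nat \<Rightarrow> nat) set) (\<rho> :: (nat \<Rightarrow> nat) \<Rightarrow> (nat \<Rightarrow> nat) \<Rightarrow> real) (T :: (nat \<Rightarrow> nat) \<Rightarrow> (nat \<Rightarrow> nat)).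
     dynamical_system X \<rho> T \<and> weak_specification X \<rho> T \<and> \<not> almost_specification X \<rho> T"
  using dynamical_system_marker_space weak_specification_marker_space
    not_almost_specification_marker_space by blast

end
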